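(* Let $p$ be a prime, $\Bbbk$ an infinite field of characteristic $p$, $V$ a finite-dimensional $\Bbbk$-vector space, and $G \leq \mathrm{GL}(V)$ a nontrivial finite $p$-group. Let $\mathcal{X}$ be any set of proper subgroups of $G$, and let $R^G_{\mathcal{X}} = \Bbbk[V]^G / I^G_{\mathcal{X}}$, where $I^G_{\mathcal{X}} = \sum_{X \in \mathcal{X}} \mathrm{Tr}^G_X(\Bbbk[V]^X)$. Let $v_1,\dots,v_l$ be a basis of the fixed-point space $V^G$, extend it to a basis $v_1,\dots,v_n$ of $V$, and let $x_1,\dots,x_n$ be the dual basis of $V^*$. For $i=1,\dots,l$ put $N_i = \prod_{\sigma\in G} \sigma x_i \in \Bbbk[V]^G$, and let $\overline{N_i}$ be its image in $R^G_{\mathcal{X}}$. Then $\overline{N_1},\dots,\overline{N_l}$ is a regular sequence in $R^G_{\mathcal{X}}$.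
   Context: $\Bbbk[V] = S(V^* )$ is the symmetric algebra of $V^*$ (the polynomial ring on a basis of $V^*$), with $G$ acting by graded $\Bbbk$-algebra automorphisms via $\sigma(f) = f\circ\sigma^{-1}$; for a subgroup $H\le G$, $\Bbbk[V]^H$ is the subring of $H$-invariants. For $H \leq G$, the relative transfer is the map $\mathrm{Tr}^G_H : \Bbbk[V]^H \to \Bbbk[V]^G$, $f\mapsto \sum_{\sigma\in G/H}\sigma f$ (sum over left coset representatives); its image is an ideal of $\Bbbk[V]^G$. For a commutative graded $\Bbbk$-algebra $A$ and a graded $A$-module $M$, an element $a\in A$ is $M$-regular if multiplication by $a$ on $M$ is injective; a sequence $a_1,\dots,a_r$ is $M$-regular if $a_1$ is $M$-regular and, for $i=2,\dots,r$, $a_i$ is $M/(a_1,\dots,a_{i-1})M$-regular. "Regular sequence in $A$" means $M=A$. *)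

theory Defs
  imports
    "HOL-Algebra.QuotRing"
    "HOL-Algebra.Left_Coset"
    "HOL-Library.Poly_Mapping"
    "HOL-Computational_Algebra.Computational_Algebra"
begin

section \<open>Linear algebra\<close>

definition GL :: "('k::field \<Rightarrow> 'v::ab_group_add \<Rightarrow> 'v) \<Rightarrow> ('v \<Rightarrow> 'v) monoid" where
  "GL scale = \<lparr>carrier = {g. Vector_Spaces.linear scale scale g \<and> bij g}, monoid.mult = (\<circ>), one = id\<rparr>"

definition fixed_space :: "('v \<Rightarrow> 'v) set \<Rightarrow> 'v set" where
  "fixed_space G = {w. \<forall>\<sigma>\<in>G. \<sigma> w = w}"

definition is_basis ::
    "('k::field \<Rightarrow> 'v::ab_group_add \<Rightarrow> 'v) \<Rightarrow> (nat \<Rightarrow> 'v) \<Rightarrow> nat \<Rightarrow> 'v set \<Rightarrow> bool" where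
  "is_basis scale v n W \<longleftrightarrow>
     inj_on v {1..n} \<and> \<not> module.dependent scale (v ` {1..n}) \<and> module.span scale (v ` {1..n}) = W"

definition is_dual_basis ::
    "('k::field \<Rightarrow> 'v::ab_group_add \<Rightarrow> 'v) \<Rightarrow> (nat \<Rightarrow> 'v) \<Rightarrow> nat \<Rightarrow> (nat \<Rightarrow> 'v \<Rightarrow> 'k) \<Rightarrow> bool" where
  "is_dual_basis scale v n x \<longleftrightarrow>
     (\<forall>i\<in>{1..n}. Vector_Spaces.linear scale (*) (x i) \<and>
        (\<forall>j\<in>{1..n}. x i (v j) = (if i = j then 1 else 0)))"


section \<open>The symmetric algebra of the dual space\<close>

text \<open>
  A polynomial is a finitely supported function from monomials to coefficients, a monomial being
  a finitely supported function from (indices of) variables to exponents; addition and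
  multiplication are those of the monoid algebra. \<open>\<bbbk>[V]\<close> is the ring of polynomials in the
  variables \<open>X\<^sub>1, \<dots>, X\<^sub>n\<close>, where \<open>X\<^sub>i\<close> stands for the element \<open>x\<^sub>i\<close> of the dual basis. The type
  itself has infinitely many variables, hence the restriction in \<open>polys\<close>.
\<close>

type_synonym 'k mpoly = "(nat \<Rightarrow>\<^sub>0 nat) \<Rightarrow>\<^sub>0 'k"

definition Const :: "'k::field \<Rightarrow> 'k mpoly" where
  "Const c = Poly_Mapping.single 0 c"

definition Var :: "nat \<Rightarrow> 'k::field mpoly" where
  "Var i = Poly_Mapping.single (Poly_Mapping.single i 1) 1"

definition polys :: "nat \<Rightarrow> 'k::field mpoly set" where
  "polys n = {f. \<forall>m\<in>Poly_Mapping.keys f. Poly_Mapping.keys m \<subseteq> {1..n}}"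

definition insertion ::
    "('k::field \<Rightarrow> 'a::comm_ring_1) \<Rightarrow> (nat \<Rightarrow> 'a) \<Rightarrow> 'k mpoly \<Rightarrow> 'a" where
  "insertion h g f =
     (\<Sum>m\<in>Poly_Mapping.keys f. h (Poly_Mapping.lookup f m) *
        (\<Prod>j\<in>Poly_Mapping.keys m. g j ^ Poly_Mapping.lookup m j))"

text \<open>
  The embedding of \<open>V\<^sup>*\<close> into \<open>\<bbbk>[V]\<close>: a linear functional \<open>\<phi>\<close> equals \<open>\<Sum>\<^sub>i \<phi>(v\<^sub>i) x\<^sub>i\<close>.
\<close>

definition linear_form :: "nat \<Rightarrow> (nat \<Rightarrow> 'v) \<Rightarrow> ('v \<Rightarrow> 'k::field) \<Rightarrow> 'k mpoly" where
  "linear_form n v \<phi> = (\<Sum>i\<in>{1..n}. Const (\<phi> (v i)) * Var i)"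

text \<open>
  The action of \<open>\<sigma>\<close>: the algebra homomorphism extending \<open>\<phi> \<mapsto> \<phi> \<circ> \<sigma>\<^sup>-\<^sup>1\<close> on \<open>V\<^sup>*\<close>.
\<close>

definition act ::
    "nat \<Rightarrow> (nat \<Rightarrow> 'v) \<Rightarrow> (nat \<Rightarrow> 'v \<Rightarrow> 'k::field) \<Rightarrow> ('v \<Rightarrow> 'v) \<Rightarrow> 'k mpoly \<Rightarrow> 'k mpoly" where
  "act n v x \<sigma> = insertion Const (\<lambda>i. linear_form n v (x i \<circ> inv_into UNIV \<sigma>))"


section \<open>Invariants and relative transfer\<close>

definition invariants ::
    "nat \<Rightarrow> (nat \<Rightarrow> 'v) \<Rightarrow> (nat \<Rightarrow> 'v \<Rightarrow> 'k::field) \<Rightarrow> ('v \<Rightarrow> 'v) set \<Rightarrow> 'k mpoly set" where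
  "invariants n v x H = {f \<in> polys n. \<forall>\<sigma>\<in>H. act n v x \<sigma> f = f}"

definition invariant_ring ::
    "nat \<Rightarrow> (nat \<Rightarrow> 'v) \<Rightarrow> (nat \<Rightarrow> 'v \<Rightarrow> 'k::field) \<Rightarrow> ('v \<Rightarrow> 'v) set \<Rightarrow> 'k mpoly ring" where
  "invariant_ring n v x H =
     \<lparr>carrier = invariants n v x H, monoid.mult = (*), one = 1, zero = 0, add = (+)\<rparr>"

definition transfer ::
    "('k::field \<Rightarrow> 'v::ab_group_add \<Rightarrow> 'v) \<Rightarrow> nat \<Rightarrow> (nat \<Rightarrow> 'v) \<Rightarrow> (nat \<Rightarrow> 'v \<Rightarrow> 'k) \<Rightarrow>
     ('v \<Rightarrow> 'v) set \<Rightarrow> ('v \<Rightarrow> 'v) set \<Rightarrow> 'k mpoly \<Rightarrow> 'k mpoly" where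
  "transfer scale n v x G H f =
     (\<Sum>C\<in>lcosets\<^bsub>(GL scale)\<lparr>carrier := G\<rparr>\<^esub> H. act n v x (SOME \<sigma>. \<sigma> \<in> C) f)"

definition transfer_ideal ::
    "('k::field \<Rightarrow> 'v::ab_group_add \<Rightarrow> 'v) \<Rightarrow> nat \<Rightarrow> (nat \<Rightarrow> 'v) \<Rightarrow> (nat \<Rightarrow> 'v \<Rightarrow> 'k) \<Rightarrow>
     ('v \<Rightarrow> 'v) set \<Rightarrow> ('v \<Rightarrow> 'v) set set \<Rightarrow> 'k mpoly set" where
  "transfer_ideal scale n v x G \<X> =
     {\<Sum>X\<in>\<X>. t X | t. \<forall>X\<in>\<X>. t X \<in> transfer scale n v x G X ` invariants n v x X}"

definition orbit_norm ::
    "nat \<Rightarrow> (nat \<Rightarrow> 'v) \<Rightarrow> (nat \<Rightarrow> 'v \<Rightarrow> 'k::field) \<Rightarrow> ('v \<Rightarrow> 'v) set \<Rightarrow> nat \<Rightarrow> 'k mpoly" where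
  "orbit_norm n v x G i = (\<Prod>\<sigma>\<in>G. act n v x \<sigma> (Var i))"


section \<open>Regular sequences\<close>

text \<open>
  Multiplication by \<open>a\<close> on the \<open>A\<close>-module \<open>A/J\<close> is multiplication by the coset \<open>J + a\<close> in the
  quotient ring. The last quotient is not required to be nonzero.
\<close>

definition regular_sequence :: "('a, 'b) ring_scheme \<Rightarrow> 'a list \<Rightarrow> bool" where
  "regular_sequence A as \<longleftrightarrow>
     set as \<subseteq> carrier A \<and>
     (as \<noteq> [] \<longrightarrow> inj_on (\<lambda>y. as ! 0 \<otimes>\<^bsub>A\<^esub> y) (carrier A)) \<and>
     (\<forall>i. 0 < i \<and> i < length as \<longrightarrow>
        (let J = genideal A (set (take i as))
         in inj_on (\<lambda>Y. (J +>\<^bsub>A\<^esub> as ! i) \<otimes>\<^bsub>A Quot J\<^esub> Y) (carrier (A Quot J))))"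

end

theory Submission
  imports Defs
begin

text \<open>
  For \<open>i \<le> l\<close> the vector \<open>v\<^sub>i\<close> is fixed by \<open>G\<close>, so \<open>\<sigma> x\<^sub>i - x\<^sub>i\<close> and, for \<open>j \<noteq> i\<close>, \<open>\<sigma> x\<^sub>j\<close> do not
  involve \<open>x\<^sub>i\<close>. Hence \<open>G\<close> preserves the degree in \<open>x\<^sub>i\<close>, the norm \<open>N\<^sub>i\<close> is monic of degree \<open>|G|\<close> in \<open>x\<^sub>i\<close>,
  and \<open>N\<^sub>j\<close> does not involve \<open>x\<^sub>i\<close> for \<open>j \<noteq> i\<close>, \<open>j \<le> l\<close>. Let \<open>q f\<close> be the quotient of \<open>f\<close> on division by
  \<open>N\<^sub>i\<close> as polynomials in \<open>x\<^sub>i\<close>. By uniqueness of division \<open>q\<close> is additive and commutes with \<open>G\<close> and with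
  multiplication by the other \<open>N\<^sub>j\<close>, and \<open>q (N\<^sub>i f) = f\<close>. So \<open>q\<close> preserves invariants, commutes with
  transfers and preserves the ideal of transfers. If \<open>N\<^sub>i f\<close> lies in that ideal plus the
  ideal generated by \<open>N\<^sub>1, \<dots>, N\<^sub>i\<^sub>-\<^sub>1\<close>, then applying \<open>q\<close> shows the same for \<open>f\<close>.
\<close>

section \<open>Polynomials\<close>

lemma poly_mapping_sum_single:
  "f = (\<Sum>m\<in>Poly_Mapping.keys f. Poly_Mapping.single m (Poly_Mapping.lookup f m))"
  by (rule poly_mapping_eqI)
    (simp add: lookup_sum lookup_single when_def not_in_keys_iff_lookup_eq_zero)

lemma keys_diff_subset:
  fixes f g :: "'a \<Rightarrow>\<^sub>0 'b::ab_group_add"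
  shows "Poly_Mapping.keys (f - g) \<subseteq> Poly_Mapping.keys f \<union> Poly_Mapping.keys g"
  by (auto simp: in_keys_iff lookup_minus)

subsection \<open>Substitution\<close>

lemma Const_0: "Const 0 = 0" and Const_1: "Const 1 = 1"
  and Const_add: "Const (a + b) = Const a + Const b"
  and Const_mult: "Const (a * b) = Const a * Const b"
  by (simp_all add: Const_def single_add mult_single)

lemma Const_sum: "Const (sum f S) = (\<Sum>a\<in>S. Const (f a))"
  by (induction S rule: infinite_finite_induct) (simp_all add: Const_0 Const_add)

text \<open>Isolates the inner product of \<open>insertion\<close>, so that multiplicativity can be
  settled on monomials first.\<close>

definition monomial_value :: "(nat \<Rightarrow> 'a::comm_ring_1) \<Rightarrow> (nat \<Rightarrow>\<^sub>0 nat) \<Rightarrow> 'a" where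
  "monomial_value g m = (\<Prod>j\<in>Poly_Mapping.keys m. g j ^ Poly_Mapping.lookup m j)"

text \<open>Indices outside \<open>keys m\<close> contribute factors with exponent 0. Several
  monomials can thus be compared over one common index set.\<close>

lemma monomial_value_superset:
  assumes "finite S" "Poly_Mapping.keys m \<subseteq> S"
  shows "monomial_value g m = (\<Prod>j\<in>S. g j ^ Poly_Mapping.lookup m j)"
  unfolding monomial_value_def
  by (rule prod.mono_neutral_left) (use assms in \<open>auto simp: not_in_keys_iff_lookup_eq_zero\<close>)

lemma monomial_value_add: "monomial_value g (m + m') = monomial_value g m * monomial_value g m'"
proof -
  let ?S = "Poly_Mapping.keys m \<union> Poly_Mapping.keys m'"
  have "Poly_Mapping.keys (m + m') \<subseteq> ?S" by (rule keys_add)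
  then show ?thesis
    by (simp add: monomial_value_superset[where S = ?S] prod.distrib lookup_add power_add)
qed

lemma insertion_superset:
  assumes "finite S" "Poly_Mapping.keys f \<subseteq> S"
  shows "insertion Const g f = (\<Sum>m\<in>S. Const (Poly_Mapping.lookup f m) * monomial_value g m)"
  unfolding insertion_def monomial_value_def
  by (rule sum.mono_neutral_left)
    (use assms in \<open>auto simp: not_in_keys_iff_lookup_eq_zero Const_0\<close>)

lemma insertion_add: "insertion Const g (f + f') = insertion Const g f + insertion Const g f'"
proof -
  let ?S = "Poly_Mapping.keys f \<union> Poly_Mapping.keys f'"
  have "Poly_Mapping.keys (f + f') \<subseteq> ?S" by (rule keys_add)
  then show ?thesis
    by (simp add: insertion_superset[where S = ?S] lookup_add Const_add distrib_right sum.distrib)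
qed

lemma insertion_0: "insertion Const g 0 = 0"
  by (simp add: insertion_def)

lemma insertion_sum: "insertion Const g (sum f S) = (\<Sum>a\<in>S. insertion Const g (f a))"
  by (induction S rule: infinite_finite_induct) (simp_all add: insertion_0 insertion_add)

lemma insertion_single:
  "insertion Const g (Poly_Mapping.single m c) = Const c * monomial_value g m"
  by (simp add: insertion_superset[where S = "{m}"])

text \<open>Both sides are biadditive in \<open>f\<close> and \<open>f'\<close>, which reduces the
  claim to single monomials; there it is \<open>monomial_value_add\<close>.\<close>

lemma insertion_mult: "insertion Const g (f * f') = insertion Const g f * insertion Const g f'"
proof -
  let ?s = "\<lambda>f m. Poly_Mapping.single m (Poly_Mapping.lookup f m)"
  have "f * f' = (\<Sum>m\<in>Poly_Mapping.keys f. ?s f m) * (\<Sum>m\<in>Poly_Mapping.keys f'. ?s f' m)"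
    using poly_mapping_sum_single[of f] poly_mapping_sum_single[of f'] by simp
  also have "\<dots> = (\<Sum>m\<in>Poly_Mapping.keys f. \<Sum>m'\<in>Poly_Mapping.keys f'. ?s f m * ?s f' m')"
    by (rule sum_product)
  finally have "insertion Const g (f * f') =
      (\<Sum>m\<in>Poly_Mapping.keys f. \<Sum>m'\<in>Poly_Mapping.keys f'.
        insertion Const g (?s f m) * insertion Const g (?s f' m'))"
    by (simp add: insertion_sum insertion_single mult_single Const_mult monomial_value_add mult_ac)
  also have "\<dots> = insertion Const g f * insertion Const g f'"
    \<comment> \<open>The third occurrences of \<open>f\<close> and \<open>f'\<close> are those on
      the right-hand side; the ones inside the double sum must stay untouched.\<close>
    by (subst (3) poly_mapping_sum_single[of f], subst (3) poly_mapping_sum_single[of f'])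
      (simp only: insertion_sum sum_product)
  finally show ?thesis .
qed

lemma insertion_Const: "insertion Const g (Const c) = Const c"
  by (simp add: Const_def[of c] insertion_single monomial_value_def)

lemma insertion_Var: "insertion Const g (Var i) = g i"
  by (simp add: Var_def insertion_single monomial_value_def Const_1)

lemma insertion_1: "insertion Const g 1 = 1"
  using insertion_Const[of g 1] by (simp add: Const_1)

lemma insertion_power: "insertion Const g (f ^ k) = insertion Const g f ^ k"
  by (induction k) (simp_all add: insertion_1 insertion_mult)

lemma insertion_prod: "insertion Const g (prod f S) = (\<Prod>a\<in>S. insertion Const g (f a))"
  by (induction S rule: infinite_finite_induct) (simp_all add: insertion_1 insertion_mult)

text \<open>Substitution is a ring homomorphism fixing constants, so it passes through the sums and
  products that define the inner one. This yields the composition of two group actions.\<close>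

lemma insertion_insertion:
  "insertion Const g (insertion Const h f) = insertion Const (\<lambda>i. insertion Const g (h i)) f"
  by (simp add: insertion_def[of Const h f] insertion_def[of Const "\<lambda>i. insertion Const g (h i)" f]
      insertion_sum insertion_mult insertion_Const insertion_prod insertion_power)

text \<open>The dual basis is controlled only at indices in \<open>{1..n}\<close>; for elements of
  \<open>polys n\<close> no other index matters.\<close>

lemma insertion_cong:
  assumes "f \<in> polys n" "\<And>i. i \<in> {1..n} \<Longrightarrow> g i = h i"
  shows "insertion Const g f = insertion Const h f"
  unfolding insertion_def
proof (intro sum.cong refl arg_cong2[where f = "(*)"] prod.cong)
  fix m j assume "m \<in> Poly_Mapping.keys f" "j \<in> Poly_Mapping.keys m"
  then have "j \<in> {1..n}" using assms(1) unfolding polys_def by blast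
  then show "g j ^ Poly_Mapping.lookup m j = h j ^ Poly_Mapping.lookup m j"
    using assms(2) by simp
qed

subsection \<open>The polynomials in the first variables\<close>

lemma polys_0: "0 \<in> polys n" and polys_Const: "Const c \<in> polys n"
  and polys_1: "1 \<in> polys n"
  by (auto simp: polys_def Const_def)

lemma polys_add: "f \<in> polys n \<Longrightarrow> g \<in> polys n \<Longrightarrow> f + g \<in> polys n"
  using keys_add[of f g] by (auto simp: polys_def)

lemma polys_diff: "f \<in> polys n \<Longrightarrow> g \<in> polys n \<Longrightarrow> f - g \<in> polys n"
  using keys_diff_subset[of f g] by (auto simp: polys_def)

lemma polys_uminus: "f \<in> polys n \<Longrightarrow> - f \<in> polys n"
  using polys_diff[OF polys_0, of f n] by simp

lemma polys_mult:
  assumes "f \<in> polys n" "g \<in> polys n"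
  shows "f * g \<in> polys n"
  unfolding polys_def
proof (intro CollectI ballI)
  fix m assume "m \<in> Poly_Mapping.keys (f * g)"
  then obtain a b where "m = a + b" "a \<in> Poly_Mapping.keys f" "b \<in> Poly_Mapping.keys g"
    using keys_mult[of f g] by blast
  then show "Poly_Mapping.keys m \<subseteq> {1..n}"
    using assms keys_add[of a b] by (fastforce simp: polys_def)
qed

lemma polys_sum: "(\<And>a. a \<in> S \<Longrightarrow> f a \<in> polys n) \<Longrightarrow> sum f S \<in> polys n"
  by (induction S rule: infinite_finite_induct) (auto simp: polys_0 polys_add)

lemma polys_prod: "(\<And>a. a \<in> S \<Longrightarrow> f a \<in> polys n) \<Longrightarrow> prod f S \<in> polys n"
  by (induction S rule: infinite_finite_induct) (auto simp: polys_1 polys_mult)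

lemma polys_power: "f \<in> polys n \<Longrightarrow> f ^ k \<in> polys n"
  by (induction k) (auto simp: polys_1 polys_mult)

lemma polys_Var: "i \<in> {1..n} \<Longrightarrow> Var i \<in> polys n"
  by (auto simp: polys_def Var_def)

lemma linear_form_polys: "linear_form n v \<phi> \<in> polys n"
  unfolding linear_form_def by (intro polys_sum polys_mult polys_Const polys_Var)

lemma insertion_polys: "(\<And>i. g i \<in> polys n) \<Longrightarrow> insertion Const g f \<in> polys n"
  unfolding insertion_def by (intro polys_sum polys_mult polys_Const polys_prod polys_power)

subsection \<open>Degree in one variable and division by monic polynomials\<close>

text \<open>A strict bound spares a convention for the degree of 0. With \<open>d = Suc 0\<close> it
  says that variable \<open>i\<close> does not occur.\<close>

definition degree_less :: "nat \<Rightarrow> nat \<Rightarrow> 'k::field mpoly \<Rightarrow> bool" where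
  "degree_less i d f \<longleftrightarrow> (\<forall>m\<in>Poly_Mapping.keys f. Poly_Mapping.lookup m i < d)"

lemma degree_less_0: "degree_less i d 0"
  by (simp add: degree_less_def)

lemma degree_less_mono: "degree_less i d f \<Longrightarrow> d \<le> e \<Longrightarrow> degree_less i e f"
  by (auto simp: degree_less_def)

lemma degree_less_add: "degree_less i d f \<Longrightarrow> degree_less i d g \<Longrightarrow> degree_less i d (f + g)"
  using keys_add[of f g] by (auto simp: degree_less_def)

lemma degree_less_diff: "degree_less i d f \<Longrightarrow> degree_less i d g \<Longrightarrow> degree_less i d (f - g)"
  using keys_diff_subset[of f g] by (auto simp: degree_less_def)

lemma degree_less_sum: "(\<And>a. a \<in> S \<Longrightarrow> degree_less i d (f a)) \<Longrightarrow> degree_less i d (sum f S)"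
  by (induction S rule: infinite_finite_induct) (auto simp: degree_less_0 degree_less_add)

text \<open>The first factor has degree at most \<open>d\<close>, the second degree below
  \<open>e\<close>; this mixed form also covers \<open>e = 0\<close>, where \<open>g\<close>
  vanishes.\<close>

lemma degree_less_mult:
  assumes "degree_less i (Suc d) f" "degree_less i e g"
  shows "degree_less i (d + e) (f * g)"
  unfolding degree_less_def
proof
  fix m assume "m \<in> Poly_Mapping.keys (f * g)"
  then obtain a b where "m = a + b" "a \<in> Poly_Mapping.keys f" "b \<in> Poly_Mapping.keys g"
    using keys_mult[of f g] by blast
  then show "Poly_Mapping.lookup m i < d + e"
    using assms by (fastforce simp: degree_less_def lookup_add)
qed

lemma degree_less_Const: "degree_less i (Suc 0) (Const c)"
  by (simp add: degree_less_def Const_def)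

lemma degree_less_1: "degree_less i (Suc 0) 1"
  using degree_less_Const[of i 1] by (simp add: Const_1)

lemma degree_less_prod:
  assumes "\<And>a. a \<in> S \<Longrightarrow> degree_less i (Suc (d a)) (f a)"
  shows "degree_less i (Suc (sum d S)) (prod f S)"
  using assms
proof (induction S rule: infinite_finite_induct)
  case (insert a S)
  then show ?case using degree_less_mult[of i "d a" "f a" "Suc (sum d S)" "prod f S"] by simp
qed (simp_all add: degree_less_1)

lemma degree_less_power:
  assumes "degree_less i (Suc d) f"
  shows "degree_less i (Suc (k * d)) (f ^ k)"
  using degree_less_prod[of "{..<k}" i "\<lambda>_. d" "\<lambda>_. f"] assms by simp

lemma Var_power: "Var i ^ k = Poly_Mapping.single (Poly_Mapping.single i k) 1"
proof (induction k)
  case (Suc k)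
  then show ?case by (simp add: Var_def mult_single flip: single_add)
qed simp

lemma degree_less_Var_power: "degree_less i (Suc k) (Var i ^ k :: 'k::field mpoly)"
  by (simp add: Var_power degree_less_def)

lemma degree_less_Var: "i \<noteq> j \<Longrightarrow> degree_less i (Suc 0) (Var j)"
  by (simp add: Var_def degree_less_def lookup_single)

text \<open>Monic of degree \<open>d\<close> as a polynomial in variable \<open>i\<close>, whose
  coefficients are polynomials in the other variables.\<close>

definition monic_in :: "nat \<Rightarrow> nat \<Rightarrow> 'k::field mpoly \<Rightarrow> bool" where
  "monic_in i d f \<longleftrightarrow> degree_less i d (f - Var i ^ d)"

lemma monic_in_degree_less: "monic_in i d f \<Longrightarrow> degree_less i (Suc d) f"
  using degree_less_add[of i "Suc d" "f - Var i ^ d" "Var i ^ d"] degree_less_Var_power[of i d]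
  by (simp add: monic_in_def degree_less_mono[where e = "Suc d"])

lemma monic_in_mult:
  assumes "monic_in i d f" "monic_in i e g"
  shows "monic_in i (d + e) (f * g)"
proof -
  have "degree_less i (d + e) (f * (g - Var i ^ e))"
    using assms by (intro degree_less_mult monic_in_degree_less) (auto simp: monic_in_def)
  moreover have "degree_less i (e + d) (Var i ^ e * (f - Var i ^ d))"
    using assms by (intro degree_less_mult degree_less_Var_power) (auto simp: monic_in_def)
  ultimately have "degree_less i (d + e) (f * (g - Var i ^ e) + Var i ^ e * (f - Var i ^ d))"
    by (intro degree_less_add) (simp_all add: add.commute)
  then show ?thesis
    by (simp add: monic_in_def algebra_simps power_add)
qed

lemma monic_in_prod:
  assumes "finite S" "\<And>a. a \<in> S \<Longrightarrow> monic_in i 1 (f a)"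
  shows "monic_in i (card S) (prod f S)"
  using assms
proof (induction S rule: finite_induct)
  case empty
  then show ?case by (simp add: monic_in_def degree_less_0)
next
  case (insert a S)
  then show ?case using monic_in_mult[of i 1 "f a" "card S" "prod f S"] by simp
qed

section \<open>Uniqueness and existence of division by a monic polynomial\<close>

lemma lookup_mult_Var_power:
  "Poly_Mapping.lookup (f * Var i ^ d) (m + Poly_Mapping.single i d) = Poly_Mapping.lookup f m"
proof -
  let ?d = "Poly_Mapping.single i d"
  have "f * Var i ^ d = (\<Sum>a\<in>Poly_Mapping.keys f.
      Poly_Mapping.single (a + ?d) (Poly_Mapping.lookup f a))"
    by (subst poly_mapping_sum_single[of f]) (simp add: sum_distrib_right Var_power mult_single)
  then show ?thesis
    by (simp add: lookup_sum lookup_single when_def not_in_keys_iff_lookup_eq_zero)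
qed

text \<open>If \<open>q\<close> has degree \<open>e\<close> in variable \<open>i\<close>, then
  \<open>q * N\<close> agrees with \<open>q * Var i ^ d\<close> up to terms of degree below
  \<open>e + d\<close>. A monomial of \<open>q\<close> of top degree therefore survives in degree
  \<open>e + d\<close>, contradicting the bound \<open>d\<close>. This gives uniqueness of
  quotients.\<close>

lemma monic_in_mult_degree_less_imp_zero:
  assumes "monic_in i d N" and low: "degree_less i d (q * N)"
  shows "q = 0"
proof (rule ccontr)
  assume "q \<noteq> 0"
  then have "Poly_Mapping.keys q \<noteq> {}"
    by simp
  define e where "e = Max ((\<lambda>m. Poly_Mapping.lookup m i) ` Poly_Mapping.keys q)"
  have "e \<in> (\<lambda>m. Poly_Mapping.lookup m i) ` Poly_Mapping.keys q"
    unfolding e_def using \<open>Poly_Mapping.keys q \<noteq> {}\<close> by (intro Max_in) auto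
  then obtain m where m: "m \<in> Poly_Mapping.keys q" "Poly_Mapping.lookup m i = e" by auto
  have "degree_less i (Suc e) q"
    unfolding degree_less_def e_def by (simp add: less_Suc_eq_le)
  then have "degree_less i (e + d) (q * (N - Var i ^ d))"
    using assms(1) by (intro degree_less_mult) (auto simp: monic_in_def)
  then have "degree_less i (e + d) (q * N - q * (N - Var i ^ d))"
    using low by (intro degree_less_diff) (auto intro: degree_less_mono)
  then have "degree_less i (e + d) (q * Var i ^ d)" by (simp add: algebra_simps)
  moreover have "m + Poly_Mapping.single i d \<in> Poly_Mapping.keys (q * Var i ^ d)"
    using m(1) by (simp add: in_keys_iff lookup_mult_Var_power)
  ultimately show False
    using m(2) by (fastforce simp: degree_less_def lookup_add)
qed

text \<open>Long division by strong induction on a degree bound, one monomial at a time: a monomial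
  divisible by \<open>Var i ^ d\<close> is replaced, modulo \<open>N\<close>, by a polynomial of
  lower degree. Membership in \<open>polys n\<close> is carried along so that the quotient lies in
  the ring as well.\<close>

lemma monic_division_exists:
  assumes N: "monic_in i d N" "N \<in> polys n" and "i \<in> {1..n}" "f \<in> polys n"
  shows "\<exists>q\<in>polys n. degree_less i d (f - q * N)"
proof -
  let ?P = "\<lambda>f. \<exists>q\<in>polys n. degree_less i d (f - q * N)"
  have P_add: "?P (f + g)" if fg: "?P f" "?P g" for f g
  proof -
    obtain q r where "q \<in> polys n" "r \<in> polys n"
      "degree_less i d (f - q * N)" "degree_less i d (g - r * N)" using fg by blast
    then have "q + r \<in> polys n" "degree_less i d (f - q * N + (g - r * N))"
      by (auto intro: polys_add degree_less_add)
    then show ?thesis by (intro bexI[of _ "q + r"]) (simp_all add: algebra_simps)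
  qed
  have P_sum: "?P (sum g S)" if "\<And>a. a \<in> S \<Longrightarrow> ?P (g a)" for S and g :: "(nat \<Rightarrow>\<^sub>0 nat) \<Rightarrow> 'a mpoly"
    using that
  proof (induction S rule: infinite_finite_induct)
    case (insert a S)
    then show ?case by (simp add: P_add)
  qed (auto intro!: bexI[of _ 0] simp: degree_less_0 polys_0)
  have "?P f" if "degree_less i e f" "f \<in> polys n" for e f
    using that
  proof (induction e arbitrary: f rule: less_induct)
    case (less e)
    have "?P (Poly_Mapping.single m (Poly_Mapping.lookup f m))" if m: "m \<in> Poly_Mapping.keys f" for m
    proof (cases "Poly_Mapping.lookup m i < d")
      case True
      then show ?thesis by (intro bexI[of _ 0]) (simp_all add: polys_0 degree_less_def)
    next
      case False
      define m' where "m' = m - Poly_Mapping.single i d"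
      let ?c = "Poly_Mapping.lookup f m"
      let ?q = "Poly_Mapping.single m' ?c"
      have m': "m = m' + Poly_Mapping.single i d"
        using False by (intro poly_mapping_eqI)
          (auto simp: m'_def lookup_add lookup_minus lookup_single when_def)
      have "Poly_Mapping.keys m' \<subseteq> Poly_Mapping.keys m"
        by (auto simp: m'_def in_keys_iff lookup_minus)
      then have q: "?q \<in> polys n"
        using m \<open>f \<in> polys n\<close> by (auto simp: polys_def)
      have e: "Poly_Mapping.lookup m' i + d < e"
        using less.prems(1) m m' by (auto simp: degree_less_def lookup_add)
      have "degree_less i (Suc (Poly_Mapping.lookup m' i)) ?q"
        by (simp add: degree_less_def)
      then have low: "degree_less i (Poly_Mapping.lookup m' i + d) (?q * (N - Var i ^ d))"
        using N(1) by (intro degree_less_mult) (auto simp: monic_in_def)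
      have "?P (?q * (N - Var i ^ d))"
        using q N(2) \<open>i \<in> {1..n}\<close>
        by (intro less.IH[OF e low] polys_mult polys_diff polys_power polys_Var)
      then obtain r where "r \<in> polys n" "degree_less i d (?q * (N - Var i ^ d) - r * N)" by blast
      \<comment> \<open>Since \<open>single m ?c\<close> is
        \<open>?q * N - ?q * (N - Var i ^ d)\<close>, its quotient is \<open>?q - r\<close> and its
        remainder is the negative of the one just obtained.\<close>
      then have r: "?q - r \<in> polys n" "degree_less i d (0 - (?q * (N - Var i ^ d) - r * N))"
        using q by (blast intro: polys_diff degree_less_diff degree_less_0)+
      have "Poly_Mapping.single m ?c = ?q * Var i ^ d"
        by (simp add: Var_power mult_single m')
      then have "Poly_Mapping.single m ?c - (?q - r) * N = 0 - (?q * (N - Var i ^ d) - r * N)"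
        by (simp add: algebra_simps)
      with r show ?thesis by metis
    qed
    then have "?P (\<Sum>m\<in>Poly_Mapping.keys f. Poly_Mapping.single m (Poly_Mapping.lookup f m))"
      by (rule P_sum)
    then show ?case by (simp only: poly_mapping_sum_single[symmetric])
  qed
  \<comment> \<open>The starting bound is one more than the largest exponent. For
    \<open>f = 0\<close> the \<open>Max\<close> is unspecified, but the claim is then
    vacuous.\<close>
  moreover have "degree_less i (Suc (Max ((\<lambda>m. Poly_Mapping.lookup m i) ` Poly_Mapping.keys f))) f"
    by (simp add: degree_less_def less_Suc_eq_le)
  ultimately show ?thesis using \<open>f \<in> polys n\<close> by blast
qed

text \<open>The quotient is unique among all polynomials, so the description needs no restriction to
  \<open>polys n\<close>.\<close>

definition monic_quotient :: "nat \<Rightarrow> nat \<Rightarrow> 'k::field mpoly \<Rightarrow> 'k mpoly \<Rightarrow> 'k mpoly" where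
  "monic_quotient i d N f = (THE q. degree_less i d (f - q * N))"

text \<open>The difference of two remainders is a multiple of \<open>N\<close> of degree below
  \<open>d\<close>, hence 0. The algebraic rules for the quotient follow by exhibiting a division
  identity.\<close>

lemma monic_quotient_eqI:
  assumes "monic_in i d N" "degree_less i d (f - q * N)"
  shows "monic_quotient i d N f = q"
  unfolding monic_quotient_def
proof (rule the_equality)
  fix q' assume "degree_less i d (f - q' * N)"
  then have "degree_less i d (f - q * N - (f - q' * N))"
    by (rule degree_less_diff[OF assms(2)])
  then have "degree_less i d ((q' - q) * N)" by (simp add: algebra_simps)
  then show "q' = q" using monic_in_mult_degree_less_imp_zero[OF assms(1)] by fastforce
qed (fact assms(2))

lemma monic_quotient:
  assumes "monic_in i d N" "N \<in> polys n" "i \<in> {1..n}" "f \<in> polys n"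
  shows monic_quotient_polys: "monic_quotient i d N f \<in> polys n"
    and degree_less_monic_quotient: "degree_less i d (f - monic_quotient i d N f * N)"
proof -
  obtain q where "q \<in> polys n" "degree_less i d (f - q * N)"
    using monic_division_exists[OF assms] by blast
  then show "monic_quotient i d N f \<in> polys n"
    "degree_less i d (f - monic_quotient i d N f * N)"
    using monic_quotient_eqI[OF assms(1)] by auto
qed

lemma monic_quotient_add:
  assumes "monic_in i d N" "N \<in> polys n" "i \<in> {1..n}" "f \<in> polys n" "g \<in> polys n"
  shows "monic_quotient i d N (f + g) = monic_quotient i d N f + monic_quotient i d N g"
  using degree_less_add[OF degree_less_monic_quotient[OF assms(1-4)]
      degree_less_monic_quotient[OF assms(1-3,5)]]
  by (intro monic_quotient_eqI[OF assms(1)]) (simp add: algebra_simps)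

lemma monic_quotient_mult_self:
  "monic_in i d N \<Longrightarrow> monic_quotient i d N (N * f) = f"
  by (rule monic_quotient_eqI) (simp_all add: degree_less_0 mult.commute)

text \<open>Multiplying a division identity by a polynomial free of variable \<open>i\<close> keeps
  the remainder below degree \<open>d\<close>.\<close>

lemma monic_quotient_mult:
  assumes "monic_in i d N" "N \<in> polys n" "i \<in> {1..n}" "f \<in> polys n" "degree_less i (Suc 0) g"
  shows "monic_quotient i d N (g * f) = g * monic_quotient i d N f"
  using degree_less_mult[OF assms(5) degree_less_monic_quotient[OF assms(1-4)]]
  by (intro monic_quotient_eqI[OF assms(1)]) (simp add: algebra_simps)

section \<open>Regular sequences from additive retractions\<close>

text \<open>A multiple \<open>c \<otimes> s\<close> of a generator goes to
  \<open>s \<otimes> q c\<close>, which is again in the ideal; additivity handles sums of such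
  multiples.\<close>

lemma (in cring) additive_map_genideal:
  assumes "S \<subseteq> carrier R"
    and q: "q \<in> carrier R \<rightarrow> carrier R"
    and q_add: "\<And>y z. y \<in> carrier R \<Longrightarrow> z \<in> carrier R \<Longrightarrow> q (y \<oplus> z) = q y \<oplus> q z"
    and q_mult: "\<And>s y. s \<in> S \<Longrightarrow> y \<in> carrier R \<Longrightarrow> q (s \<otimes> y) = s \<otimes> q y"
    and "y \<in> Idl S"
  shows "q y \<in> Idl S"
proof -
  interpret J: ideal "Idl S" R by (rule genideal_ideal[OF assms(1)])
  \<comment> \<open>As \<open>q\<close> is only additive, \<open>{y. q y \<in> Idl S}\<close> need not be an ideal; its elements all of
    whose multiples it contains do form one.\<close>
  define K where "K = {y \<in> Idl S. \<forall>c\<in>carrier R. q (c \<otimes> y) \<in> Idl S}"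
  have q0: "q \<zero> = \<zero>"
  proof -
    have "q \<zero> \<oplus> q \<zero> = q \<zero>" using q_add[of \<zero> \<zero>] by simp
    moreover have "q \<zero> \<in> carrier R" using q by auto
    ultimately show ?thesis by simp
  qed
  have q_uminus: "q (\<ominus> z) = \<ominus> q z" if "z \<in> carrier R" for z
  proof -
    have "q (\<ominus> z) \<oplus> q z = q (\<ominus> z \<oplus> z)" using that by (simp add: q_add)
    also have "\<dots> = \<zero>" using that by (simp add: l_neg q0)
    finally show ?thesis using q that by (intro minus_equality[symmetric]) auto
  qed
  have "ideal K R"
  proof (rule idealI)
    show "subgroup K (add_monoid R)"
    proof
      fix y z assume "y \<in> K" "z \<in> K"
      then show "y \<otimes>\<^bsub>add_monoid R\<^esub> z \<in> K"
        by (auto simp: K_def r_distr q_add)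
    next
      fix y assume "y \<in> K"
      then show "inv\<^bsub>add_monoid R\<^esub> y \<in> K"
        by (auto simp: K_def r_minus q_uminus simp flip: a_inv_def)
    qed (auto simp: K_def q0)
  next
    fix y c assume y: "y \<in> K" and c: "c \<in> carrier R"
    have "q (d \<otimes> (c \<otimes> y)) \<in> Idl S" if "d \<in> carrier R" for d
      using y c that by (simp add: K_def flip: m_assoc)
    then show cy: "c \<otimes> y \<in> K"
      using y c by (auto simp: K_def J.I_l_closed)
    then show "y \<otimes> c \<in> K"
      using y c by (simp add: K_def m_comm)
  qed (rule ring_axioms)
  moreover have "S \<subseteq> K"
  proof
    fix s assume s: "s \<in> S"
    then have sJ: "s \<in> Idl S" using genideal_self[OF assms(1)] by blast
    moreover have "q (c \<otimes> s) \<in> Idl S" if "c \<in> carrier R" for c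
    proof -
      have "q (c \<otimes> s) = s \<otimes> q c" using s assms(1) that by (subst m_comm) (auto simp: q_mult)
      then show ?thesis using sJ q that by (auto intro!: J.I_r_closed)
    qed
    ultimately show "s \<in> K" by (simp add: K_def)
  qed
  ultimately have "Idl S \<subseteq> K" by (rule genideal_minimal)
  then have "y \<in> K" using \<open>y \<in> Idl S\<close> by blast
  then have "q (\<one> \<otimes> y) \<in> Idl S" unfolding K_def by blast
  then show ?thesis using \<open>y \<in> Idl S\<close> by simp
qed

text \<open>Commuting with the earlier elements makes \<open>q\<close> preserve the ideal they
  generate. It then remains a left inverse of multiplication by \<open>as ! i\<close> modulo that
  ideal, which forces injectivity.\<close>

lemma (in cring) regular_sequenceI:
  assumes as: "set as \<subseteq> carrier R"
    and retraction: "\<And>i. i < length as \<Longrightarrow> \<exists>q \<in> carrier R \<rightarrow> carrier R.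
      (\<forall>y\<in>carrier R. \<forall>z\<in>carrier R. q (y \<oplus> z) = q y \<oplus> q z) \<and>
      (\<forall>y\<in>carrier R. q (as ! i \<otimes> y) = y) \<and>
      (\<forall>j<i. \<forall>y\<in>carrier R. q (as ! j \<otimes> y) = as ! j \<otimes> q y)"
  shows "regular_sequence R as"
  unfolding regular_sequence_def Let_def
proof (intro conjI allI impI as)
  assume "as \<noteq> []"
  then obtain q where "\<forall>y\<in>carrier R. q (as ! 0 \<otimes> y) = y"
    using retraction[of 0] by auto
  then show "inj_on (\<lambda>y. as ! 0 \<otimes> y) (carrier R)"
    by (intro inj_on_inverseI[of _ q]) auto
next
  fix i assume i: "0 < i \<and> i < length as"
  define S where "S = set (take i as)"
  let ?s = "as ! i"
  have S: "S \<subseteq> carrier R" using as set_take_subset[of i as] by (auto simp: S_def)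
  have s: "?s \<in> carrier R" using as i by auto
  obtain q where q: "q \<in> carrier R \<rightarrow> carrier R"
    and q_add: "\<forall>y\<in>carrier R. \<forall>z\<in>carrier R. q (y \<oplus> z) = q y \<oplus> q z"
    and q_s: "\<forall>y\<in>carrier R. q (?s \<otimes> y) = y"
    and q_S: "\<forall>j<i. \<forall>y\<in>carrier R. q (as ! j \<otimes> y) = as ! j \<otimes> q y"
    using retraction[OF conjunct2[OF i]] by (elim bexE conjE) (rule that)
  interpret J: ideal "Idl S" R by (rule genideal_ideal[OF S])
  have closed: "q y \<in> Idl S" if "y \<in> Idl S" for y
    using that q_S by (intro additive_map_genideal[OF S q]) (auto simp: q_add S_def in_set_conv_nth)
  show "inj_on (\<lambda>Y. (genideal R (set (take i as)) +> ?s)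
      \<otimes>\<^bsub>R Quot genideal R (set (take i as))\<^esub> Y) (carrier (R Quot genideal R (set (take i as))))"
    unfolding S_def[symmetric]
  proof (rule inj_onI)
    fix Y Z assume "Y \<in> carrier (R Quot Idl S)" "Z \<in> carrier (R Quot Idl S)"
      and eq: "(Idl S +> ?s) \<otimes>\<^bsub>R Quot Idl S\<^esub> Y = (Idl S +> ?s) \<otimes>\<^bsub>R Quot Idl S\<^esub> Z"
    then obtain y z where y: "y \<in> carrier R" "Y = Idl S +> y" and z: "z \<in> carrier R" "Z = Idl S +> z"
      by (auto simp: FactRing_simps)
    have "Idl S +> (?s \<otimes> y) = Idl S +> (?s \<otimes> z)"
      using eq y z s by (simp add: FactRing_def J.rcoset_mult_add)
    then have "?s \<otimes> y \<ominus> ?s \<otimes> z \<in> Idl S"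
      using y z s by (simp add: quotient_eq_iff_same_a_r_cos[OF J.is_ideal])
    then have "?s \<otimes> (y \<ominus> z) \<in> Idl S"
      using y z s by (simp add: r_distr r_minus minus_eq)
    \<comment> \<open>Applying \<open>q\<close> removes the factor \<open>?s\<close> without leaving
      the ideal.\<close>
    then have "y \<ominus> z \<in> Idl S"
      using closed q_s y z by fastforce
    then show "Y = Z"
      using y z by (simp add: quotient_eq_iff_same_a_r_cos[OF J.is_ideal])
  qed
qed

text \<open>A map preserving \<open>I\<close> descends to the quotient by \<open>I\<close>, where it
  satisfies the hypotheses of \<open>regular_sequenceI\<close>.\<close>

lemma (in cring) regular_sequence_QuotI:
  assumes "ideal I R" and N: "\<And>i. i \<in> {1..l} \<Longrightarrow> N i \<in> carrier R"
    and retraction: "\<And>i. i \<in> {1..l} \<Longrightarrow> \<exists>q \<in> carrier R \<rightarrow> carrier R. q ` I \<subseteq> I \<and>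
      (\<forall>y\<in>carrier R. \<forall>z\<in>carrier R. q (y \<oplus> z) = q y \<oplus> q z) \<and>
      (\<forall>y\<in>carrier R. q (N i \<otimes> y) = y) \<and>
      (\<forall>j\<in>{1..l} - {i}. \<forall>y\<in>carrier R. q (N j \<otimes> y) = N j \<otimes> q y)"
  shows "regular_sequence (R Quot I) (map (\<lambda>i. I +> N i) [1..<Suc l])"
proof -
  interpret I: ideal I R by fact
  interpret Q: cring "R Quot I" by (rule I.quotient_is_cring[OF is_cring])
  have carr: "carrier (R Quot I) = (+>) I ` carrier R"
    by (auto simp: FactRing_simps)
  have mult: "(I +> y) \<otimes>\<^bsub>R Quot I\<^esub> (I +> z) = I +> (y \<otimes> z)"
    and add: "(I +> y) \<oplus>\<^bsub>R Quot I\<^esub> (I +> z) = I +> (y \<oplus> z)"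
    if "y \<in> carrier R" "z \<in> carrier R" for y z
    using that by (simp_all add: FactRing_def I.rcoset_mult_add I.a_rcos_sum)
  show ?thesis
  proof (rule Q.regular_sequenceI)
    show "set (map (\<lambda>i. I +> N i) [1..<Suc l]) \<subseteq> carrier (R Quot I)"
      using N by (auto simp: carr)
  next
    fix k assume "k < length (map (\<lambda>i. I +> N i) [1..<Suc l])"
    then have k: "k < l" by (simp del: upt_Suc)
    then have i: "Suc k \<in> {1..l}" by simp
    obtain q where q: "q \<in> carrier R \<rightarrow> carrier R" and q_I: "q ` I \<subseteq> I"
      and q_add: "\<forall>y\<in>carrier R. \<forall>z\<in>carrier R. q (y \<oplus> z) = q y \<oplus> q z"
      and q_same: "\<forall>y\<in>carrier R. q (N (Suc k) \<otimes> y) = y"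
      and q_other: "\<forall>j\<in>{1..l} - {Suc k}. \<forall>y\<in>carrier R. q (N j \<otimes> y) = N j \<otimes> q y"
      using retraction[OF i] by blast
    \<comment> \<open>The map induced on cosets, through an arbitrary representative. Independence
      of the choice follows from additivity and \<open>q\<close> mapping \<open>I\<close> into
      itself.\<close>
    define q' where "q' Y = I +> q (SOME y. y \<in> carrier R \<and> Y = I +> y)" for Y
    have q'_coset: "q' (I +> y) = I +> q y" if y: "y \<in> carrier R" for y
    proof -
      define z where "z = (SOME z. z \<in> carrier R \<and> I +> y = I +> z)"
      have z: "z \<in> carrier R \<and> I +> y = I +> z"
        unfolding z_def by (rule someI[of _ y]) (simp add: y)
      then have "y \<ominus> z \<in> I"
        using y by (simp add: quotient_eq_iff_same_a_r_cos[OF I.is_ideal])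
      then have "q (y \<ominus> z) \<in> I" using q_I by blast
      moreover have "q (y \<ominus> z) \<oplus> q z = q (y \<ominus> z \<oplus> z)"
        using q_add y z by simp
      then have "q (y \<ominus> z) \<oplus> q z = q y"
        using y z by (simp add: minus_eq a_assoc l_neg)
      then have "q (y \<ominus> z) = q y \<ominus> q z"
        using q y z by (metis PiE minus_closed add.inv_solve_right minus_eq)
      ultimately have "I +> q y = I +> q z"
        using q y z by (simp add: quotient_eq_iff_same_a_r_cos[OF I.is_ideal] Pi_iff)
      then show ?thesis by (simp add: q'_def z_def)
    qed
    \<comment> \<open>List positions start at 0 and the norms at 1, hence the shift by
      \<open>Suc\<close>.\<close>
    have nth: "map (\<lambda>i. I +> N i) [1..<Suc l] ! j = I +> N (Suc j)" if "j < l" for j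
      using that by (simp del: upt_Suc)
    show "\<exists>q' \<in> carrier (R Quot I) \<rightarrow> carrier (R Quot I).
      (\<forall>Y\<in>carrier (R Quot I). \<forall>Z\<in>carrier (R Quot I).
        q' (Y \<oplus>\<^bsub>R Quot I\<^esub> Z) = q' Y \<oplus>\<^bsub>R Quot I\<^esub> q' Z) \<and>
      (\<forall>Y\<in>carrier (R Quot I).
        q' (map (\<lambda>i. I +> N i) [1..<Suc l] ! k \<otimes>\<^bsub>R Quot I\<^esub> Y) = Y) \<and>
      (\<forall>j<k. \<forall>Y\<in>carrier (R Quot I).
        q' (map (\<lambda>i. I +> N i) [1..<Suc l] ! j \<otimes>\<^bsub>R Quot I\<^esub> Y) =
        map (\<lambda>i. I +> N i) [1..<Suc l] ! j \<otimes>\<^bsub>R Quot I\<^esub> q' Y)"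
    proof (intro bexI[of _ q'] conjI ballI allI impI)
      fix Y Z assume "Y \<in> carrier (R Quot I)" "Z \<in> carrier (R Quot I)"
      then show "q' (Y \<oplus>\<^bsub>R Quot I\<^esub> Z) = q' Y \<oplus>\<^bsub>R Quot I\<^esub> q' Z"
        using q by (auto simp: carr add q'_coset q_add Pi_iff)
    next
      fix Y assume "Y \<in> carrier (R Quot I)"
      then show "q' (map (\<lambda>i. I +> N i) [1..<Suc l] ! k \<otimes>\<^bsub>R Quot I\<^esub> Y) = Y"
        using N[OF i] k by (auto simp: carr nth mult q'_coset q_same simp del: upt_Suc)
    next
      fix j Y assume j: "j < k" and "Y \<in> carrier (R Quot I)"
      then obtain y where y: "y \<in> carrier R" "Y = I +> y" by (auto simp: carr)
      have "N (Suc j) \<in> carrier R" using j k by (intro N) auto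
      then show "q' (map (\<lambda>i. I +> N i) [1..<Suc l] ! j \<otimes>\<^bsub>R Quot I\<^esub> Y) =
        map (\<lambda>i. I +> N i) [1..<Suc l] ! j \<otimes>\<^bsub>R Quot I\<^esub> q' Y"
        using y j k q by (auto simp: nth mult q'_coset q_other Pi_iff simp del: upt_Suc)
    qed (use q in \<open>auto simp: carr q'_coset\<close>)
  qed
qed

section \<open>The action on polynomials\<close>

lemma act_add: "act n v x \<sigma> (f + g) = act n v x \<sigma> f + act n v x \<sigma> g"
  and act_0: "act n v x \<sigma> 0 = 0" and act_1: "act n v x \<sigma> 1 = 1"
  and act_mult: "act n v x \<sigma> (f * g) = act n v x \<sigma> f * act n v x \<sigma> g"
  and act_sum: "act n v x \<sigma> (sum h S) = (\<Sum>a\<in>S. act n v x \<sigma> (h a))"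
  and act_prod: "act n v x \<sigma> (prod h S) = (\<Prod>a\<in>S. act n v x \<sigma> (h a))"
  and act_Var: "act n v x \<sigma> (Var i) = linear_form n v (x i \<circ> inv_into UNIV \<sigma>)"
  by (simp_all add: act_def insertion_add insertion_0 insertion_1 insertion_mult insertion_sum
      insertion_prod insertion_Var)

lemma act_diff: "act n v x \<sigma> (f - g) = act n v x \<sigma> f - act n v x \<sigma> g"
  using act_add[of n v x \<sigma> "f - g" g] by simp

lemma act_uminus: "act n v x \<sigma> (- f) = - act n v x \<sigma> f"
  using act_diff[of n v x \<sigma> 0 f] by (simp add: act_0)

lemma act_polys: "act n v x \<sigma> f \<in> polys n"
  unfolding act_def by (intro insertion_polys linear_form_polys)

section \<open>The ring of invariants and its ideals\<close>

lemma invariants_0: "0 \<in> invariants n v x H" and invariants_1: "1 \<in> invariants n v x H"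
  and invariants_add: "f \<in> invariants n v x H \<Longrightarrow> g \<in> invariants n v x H \<Longrightarrow> f + g \<in> invariants n v x H"
  and invariants_mult: "f \<in> invariants n v x H \<Longrightarrow> g \<in> invariants n v x H \<Longrightarrow> f * g \<in> invariants n v x H"
  and invariants_uminus: "f \<in> invariants n v x H \<Longrightarrow> - f \<in> invariants n v x H"
  by (simp_all add: invariants_def polys_0 act_0 polys_1 act_1 polys_add act_add polys_mult act_mult
      polys_uminus act_uminus)

lemma invariants_sum: "(\<And>a. a \<in> S \<Longrightarrow> f a \<in> invariants n v x H) \<Longrightarrow> sum f S \<in> invariants n v x H"
  by (induction S rule: infinite_finite_induct) (auto simp: invariants_0 invariants_add)

lemma invariants_antimono: "X \<subseteq> H \<Longrightarrow> invariants n v x H \<subseteq> invariants n v x X"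
  by (auto simp: invariants_def)

lemma cring_invariant_ring: "cring (invariant_ring n v x H)"
proof (rule cringI)
  show "abelian_group (invariant_ring n v x H)"
  proof (rule abelian_groupI)
    fix f assume "f \<in> carrier (invariant_ring n v x H)"
    then show "\<exists>g\<in>carrier (invariant_ring n v x H).
        g \<oplus>\<^bsub>invariant_ring n v x H\<^esub> f = \<zero>\<^bsub>invariant_ring n v x H\<^esub>"
      by (intro bexI[of _ "- f"]) (auto simp: invariant_ring_def invariants_uminus)
  qed (simp_all add: invariant_ring_def invariants_0 invariants_add algebra_simps)
  show "comm_monoid (invariant_ring n v x H)"
    by (rule comm_monoidI) (simp_all add: invariant_ring_def invariants_1 invariants_mult mult_ac)
qed (simp add: invariant_ring_def algebra_simps)

text \<open>Reduces the ideal axioms to ordinary polynomial arithmetic; the point to check is that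
  the additive inverse of the ring record is the usual one.\<close>

lemma ideal_invariant_ringI:
  assumes "I \<subseteq> invariants n v x H" "0 \<in> I"
    and "\<And>f g. f \<in> I \<Longrightarrow> g \<in> I \<Longrightarrow> f + g \<in> I" and "\<And>f. f \<in> I \<Longrightarrow> - f \<in> I"
    and "\<And>f g. f \<in> I \<Longrightarrow> g \<in> invariants n v x H \<Longrightarrow> f * g \<in> I"
  shows "ideal I (invariant_ring n v x H)"
proof -
  interpret A: cring "invariant_ring n v x H" by (rule cring_invariant_ring)
  have minus: "\<ominus>\<^bsub>invariant_ring n v x H\<^esub> f = - f" if "f \<in> I" for f
    using that assms(1,4)
    by (intro A.minus_equality) (auto simp: invariant_ring_def)
  show ?thesis
  proof (rule idealI)
    show "subgroup I (add_monoid (invariant_ring n v x H))"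
    proof
      show "inv\<^bsub>add_monoid (invariant_ring n v x H)\<^esub> f \<in> I" if "f \<in> I" for f
        using assms(4) minus that unfolding a_inv_def[symmetric] by simp
    qed (use assms in \<open>auto simp: invariant_ring_def\<close>)
  next
    show "ring (invariant_ring n v x H)" by (rule A.ring_axioms)
  qed (use assms in \<open>auto simp: invariant_ring_def mult.commute\<close>)
qed

section \<open>Finite linear groups and division by orbit norms\<close>

locale linear_action = vector_space scale
  for scale :: "'k::field \<Rightarrow> 'v::ab_group_add \<Rightarrow> 'v" +
  fixes l n :: nat and G :: "('v \<Rightarrow> 'v) set" and v :: "nat \<Rightarrow> 'v" and x :: "nat \<Rightarrow> 'v \<Rightarrow> 'k"
  assumes G: "subgroup G (GL scale)" and finite_G: "finite G" and l_le_n: "l \<le> n"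
    and basis: "is_basis scale v n UNIV" and dual: "is_dual_basis scale v n x"
    and v_fixed: "\<And>i. i \<in> {1..l} \<Longrightarrow> v i \<in> fixed_space G"
begin

abbreviation (input) "action \<equiv> act n v x"

lemma G_bij: "\<sigma> \<in> G \<Longrightarrow> bij \<sigma>" and G_linear: "\<sigma> \<in> G \<Longrightarrow> Vector_Spaces.linear scale scale \<sigma>"
  using subgroup.subset[OF G] by (auto simp: GL_def)

lemma G_comp: "\<sigma> \<in> G \<Longrightarrow> \<tau> \<in> G \<Longrightarrow> \<sigma> \<circ> \<tau> \<in> G"
  using subgroup.m_closed[OF G] by (auto simp: GL_def)

lemma linear_inv_G:
  assumes "\<sigma> \<in> G"
  shows "Vector_Spaces.linear scale scale (inv_into UNIV \<sigma>)"
proof -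
  have inj: "inj \<sigma>" and surj: "surj \<sigma>"
    using G_bij[OF assms] by (auto simp: bij_def)
  have add: "\<sigma> (a + b) = \<sigma> a + \<sigma> b" and scale: "\<sigma> (scale c a) = scale c (\<sigma> a)" for a b c
    using G_linear[OF assms] by (auto simp: Vector_Spaces.linear_iff)
  have "inv_into UNIV \<sigma> (a + b) = inv_into UNIV \<sigma> a + inv_into UNIV \<sigma> b" for a b
    by (rule inv_f_eq[OF inj]) (simp add: add surj_f_inv_f[OF surj])
  moreover have "inv_into UNIV \<sigma> (scale c a) = scale c (inv_into UNIV \<sigma> a)" for a c
    by (rule inv_f_eq[OF inj]) (simp add: scale surj_f_inv_f[OF surj])
  ultimately show ?thesis
    by (simp add: Vector_Spaces.linear_iff vector_space_axioms)
qed

lemma x_linear: "i \<in> {1..n} \<Longrightarrow> Vector_Spaces.linear scale (*) (x i)"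
  and x_v: "i \<in> {1..n} \<Longrightarrow> j \<in> {1..n} \<Longrightarrow> x i (v j) = (if i = j then 1 else 0)"
  using dual by (auto simp: is_dual_basis_def)

text \<open>Applying \<open>x i\<close> to any expansion of \<open>w\<close> in the basis isolates
  the coefficient of \<open>v i\<close>.\<close>

lemma dual_expansion: "(\<Sum>j\<in>{1..n}. scale (x j w) (v j)) = w"
proof -
  have inj: "inj_on v {1..n}" and "w \<in> span (v ` {1..n})"
    using basis by (auto simp: is_basis_def)
  then obtain u where "w = (\<Sum>a\<in>v ` {1..n}. scale (u a) a)"
    by (auto simp: span_finite)
  then have w: "w = (\<Sum>j\<in>{1..n}. scale (u (v j)) (v j))"
    by (simp only: sum.reindex[OF inj] o_def)
  have "x i w = u (v i)" if i: "i \<in> {1..n}" for i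
  proof -
    interpret x: Vector_Spaces.linear scale "(*)" "x i" by (rule x_linear[OF i])
    have "x i w = (\<Sum>j\<in>{1..n}. u (v j) * x i (v j))"
      by (subst w) (simp add: x.sum x.scale)
    also have "\<dots> = (\<Sum>j\<in>{1..n}. if j = i then u (v j) else 0)"
      using i by (intro sum.cong) (auto simp: x_v)
    finally show ?thesis using i by simp
  qed
  then show ?thesis using w by simp
qed

text \<open>Both sides are substitutions, so it suffices to compare them on variables. There the
  claim is a matrix product for the inverses, and the inverse in the action makes the order come out
  as \<open>\<sigma> \<circ> \<tau>\<close>.\<close>

lemma action_comp:
  assumes "\<sigma> \<in> G" "\<tau> \<in> G" "f \<in> polys n"
  shows "action \<sigma> (action \<tau> f) = action (\<sigma> \<circ> \<tau>) f"
proof -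
  have "action \<sigma> (linear_form n v (x i \<circ> inv_into UNIV \<tau>)) =
      linear_form n v (x i \<circ> inv_into UNIV (\<sigma> \<circ> \<tau>))" if i: "i \<in> {1..n}" for i
  proof -
    let ?\<sigma> = "inv_into UNIV \<sigma>" and ?\<tau> = "inv_into UNIV \<tau>"
    interpret x: Vector_Spaces.linear scale "(*)" "x i" by (rule x_linear[OF i])
    interpret t: Vector_Spaces.linear scale scale ?\<tau> by (rule linear_inv_G[OF assms(2)])
    \<comment> \<open>Expand \<open>w\<close> in the basis and use linearity of \<open>x i\<close>
      after the inverse of \<open>\<tau>\<close>; later \<open>w\<close> is the image of
      \<open>v k\<close> under the inverse of \<open>\<sigma>\<close>.\<close>
    have "(\<Sum>j\<in>{1..n}. x i (?\<tau> (v j)) * x j w) = x i (?\<tau> w)" for w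
      by (subst (2) dual_expansion[of w, symmetric]) (simp add: x.sum x.scale t.sum t.scale mult.commute)
    note expand = this
    have "action \<sigma> (linear_form n v (x i \<circ> ?\<tau>)) =
        (\<Sum>j\<in>{1..n}. Const (x i (?\<tau> (v j))) * (\<Sum>k\<in>{1..n}. Const (x j (?\<sigma> (v k))) * Var k))"
      unfolding linear_form_def[of n v "x i \<circ> ?\<tau>"]
      by (simp add: act_sum act_mult act_Var linear_form_def)
        (simp add: act_def insertion_Const)
    also have "\<dots> = (\<Sum>k\<in>{1..n}. Const (\<Sum>j\<in>{1..n}. x i (?\<tau> (v j)) * x j (?\<sigma> (v k))) * Var k)"
      unfolding Const_sum Const_mult sum_distrib_left sum_distrib_right mult.assoc
      by (rule sum.swap)
    also have "\<dots> = linear_form n v (x i \<circ> inv_into UNIV (\<sigma> \<circ> \<tau>))"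
      using assms by (simp add: expand linear_form_def o_inv_distrib G_bij del: One_nat_def)
    finally show ?thesis .
  qed
  then show ?thesis
    unfolding act_def insertion_insertion using assms(3) by (intro insertion_cong) auto
qed

text \<open>The coefficient of \<open>Var i\<close> in the image of \<open>Var j\<close> is
  \<open>x j\<close> at the preimage of \<open>v i\<close>. As \<open>v i\<close> is fixed, this is
  \<open>x j (v i)\<close>, which is 1 or 0.\<close>

lemma action_Var_degree:
  assumes i: "i \<in> {1..l}" and j: "j \<in> {1..n}" and \<sigma>: "\<sigma> \<in> G"
  shows "degree_less i (Suc 0) (action \<sigma> (Var j) - (if i = j then Var i else 0))"
proof -
  have "\<sigma> (v i) = v i" using v_fixed[OF i] \<sigma> by (simp add: fixed_space_def)
  then have inv: "inv_into UNIV \<sigma> (v i) = v i"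
    using G_bij[OF \<sigma>] by (metis bij_def inv_f_f)
  have i': "i \<in> {1..n}" using i l_le_n by auto
  have "action \<sigma> (Var j) = Const (x j (v i)) * Var i +
      (\<Sum>k\<in>{1..n} - {i}. Const (x j (inv_into UNIV \<sigma> (v k))) * Var k)"
    using i' by (simp add: act_Var linear_form_def inv sum.remove[of "{1..n}" i] del: One_nat_def)
  then have eq: "action \<sigma> (Var j) - (if i = j then Var i else 0) =
      (\<Sum>k\<in>{1..n} - {i}. Const (x j (inv_into UNIV \<sigma> (v k))) * Var k)"
    using i' j by (auto simp: x_v Const_0 Const_1)
  show ?thesis
    unfolding eq
  proof (rule degree_less_sum)
    fix k assume "k \<in> {1..n} - {i}"
    then show "degree_less i (Suc 0) (Const (x j (inv_into UNIV \<sigma> (v k))) * Var k)"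
      using degree_less_mult[OF degree_less_Const degree_less_Var[of i k]] by simp
  qed
qed

text \<open>A monomial becomes a product of powers of linear forms. Only the form replacing
  \<open>Var i\<close> involves variable \<open>i\<close>, and it does so linearly, so the degree
  bound persists.\<close>

lemma action_degree_less:
  assumes i: "i \<in> {1..l}" and \<sigma>: "\<sigma> \<in> G" and f: "f \<in> polys n" "degree_less i d f"
  shows "degree_less i d (action \<sigma> f)"
  unfolding act_def insertion_def
proof (rule degree_less_sum)
  fix m assume m: "m \<in> Poly_Mapping.keys f"
  let ?g = "\<lambda>j. linear_form n v (x j \<circ> inv_into UNIV \<sigma>)"
  have "degree_less i (Suc (\<Sum>j\<in>Poly_Mapping.keys m. if j = i then Poly_Mapping.lookup m j else 0))
      (\<Prod>j\<in>Poly_Mapping.keys m. ?g j ^ Poly_Mapping.lookup m j)"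
  proof (rule degree_less_prod)
    fix j assume "j \<in> Poly_Mapping.keys m"
    then have j: "j \<in> {1..n}" using m f(1) unfolding polys_def by blast
    have "degree_less i (Suc (if j = i then 1 else 0)) (?g j)"
    proof (cases "j = i")
      case True
      then have "degree_less i 2 (?g j - Var i + Var i)"
        using action_Var_degree[OF i j \<sigma>] degree_less_Var_power[of i 1]
        by (intro degree_less_add) (auto simp: act_Var numeral_2_eq_2 intro: degree_less_mono)
      with True show ?thesis by (simp add: numeral_2_eq_2)
    next
      case False
      then show ?thesis using action_Var_degree[OF i j \<sigma>] by (simp add: act_Var)
    qed
    from degree_less_power[OF this]
    show "degree_less i (Suc (if j = i then Poly_Mapping.lookup m j else 0))
        (?g j ^ Poly_Mapping.lookup m j)"
      by (cases "j = i") simp_all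
  qed
  then have "degree_less i (Suc (Poly_Mapping.lookup m i))
      (\<Prod>j\<in>Poly_Mapping.keys m. ?g j ^ Poly_Mapping.lookup m j)"
    by (simp add: not_in_keys_iff_lookup_eq_zero split: if_splits)
  then have "degree_less i d (\<Prod>j\<in>Poly_Mapping.keys m. ?g j ^ Poly_Mapping.lookup m j)"
    by (rule degree_less_mono) (use f(2) m in \<open>auto simp: degree_less_def Suc_le_eq\<close>)
  from degree_less_mult[OF degree_less_Const this]
  show "degree_less i d (Const (Poly_Mapping.lookup f m) *
      (\<Prod>j\<in>Poly_Mapping.keys m. ?g j ^ Poly_Mapping.lookup m j))" by simp
qed

section \<open>Orbit norms as invariant monic polynomials\<close>

abbreviation (input) "N \<equiv> orbit_norm n v x G"

lemma orbit_norm_polys: "N i \<in> polys n"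
  unfolding orbit_norm_def by (intro polys_prod act_polys)

text \<open>Left multiplication is injective, hence a permutation of the finite group; it serves to
  reindex products over \<open>G\<close>.\<close>

lemma comp_image_G: "\<tau> \<in> G \<Longrightarrow> (\<circ>) \<tau> ` G = G" and inj_on_comp_G: "\<tau> \<in> G \<Longrightarrow> inj_on ((\<circ>) \<tau>) S"
proof -
  assume \<tau>: "\<tau> \<in> G"
  have inj: "inj ((\<circ>) \<tau>)"
    using fun.inj_map[OF bij_is_inj[OF G_bij[OF \<tau>]]] .
  then show "inj_on ((\<circ>) \<tau>) S" by (rule inj_on_subset) simp
  show "(\<circ>) \<tau> ` G = G"
    using inj \<tau> by (intro endo_inj_surj finite_G) (auto intro: G_comp inj_on_subset)
qed

lemma orbit_norm_invariant:
  assumes "i \<in> {1..n}"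
  shows "N i \<in> invariants n v x G"
proof -
  have "action \<tau> (N i) = N i" if \<tau>: "\<tau> \<in> G" for \<tau>
  proof -
    have "action \<tau> (N i) = (\<Prod>\<sigma>\<in>G. action (\<tau> \<circ> \<sigma>) (Var i))"
      unfolding orbit_norm_def act_prod using \<tau> assms
      by (intro prod.cong) (auto simp: action_comp polys_Var)
    also have "\<dots> = (\<Prod>\<sigma>\<in>(\<circ>) \<tau> ` G. action \<sigma> (Var i))"
      by (simp add: prod.reindex[OF inj_on_comp_G[OF \<tau>]])
    finally show ?thesis by (simp add: comp_image_G[OF \<tau>] orbit_norm_def)
  qed
  then show ?thesis by (simp add: invariants_def orbit_norm_polys)
qed

text \<open>Each of the \<open>card G\<close> factors is \<open>Var i\<close> plus a linear form
  free of variable \<open>i\<close>.\<close>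

lemma orbit_norm_monic:
  assumes "i \<in> {1..l}"
  shows "monic_in i (card G) (N i)"
  unfolding orbit_norm_def
proof (rule monic_in_prod[OF finite_G])
  fix \<sigma> assume "\<sigma> \<in> G"
  then show "monic_in i 1 (action \<sigma> (Var i))"
    using action_Var_degree[OF assms, of i \<sigma>] assms l_le_n by (simp add: monic_in_def)
qed

lemma orbit_norm_degree:
  assumes "i \<in> {1..l}" "j \<in> {1..n}" "i \<noteq> j"
  shows "degree_less i (Suc 0) (N j)"
  using degree_less_prod[of G i "\<lambda>_. 0" "\<lambda>\<sigma>. action \<sigma> (Var j)"] action_Var_degree[OF assms(1,2)] assms(3)
  by (simp add: orbit_norm_def)

section \<open>Division by an orbit norm, compatible with the group\<close>

definition norm_quotient :: "nat \<Rightarrow> 'k mpoly \<Rightarrow> 'k mpoly" where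
  "norm_quotient i = monic_quotient i (card G) (N i)"

context
  fixes i assumes i: "i \<in> {1..l}"
begin

lemma i_le_n: "i \<in> {1..n}"
  using i l_le_n by auto

lemmas quotient_facts = orbit_norm_monic[OF i] orbit_norm_polys i_le_n

lemma norm_quotient_polys: "f \<in> polys n \<Longrightarrow> norm_quotient i f \<in> polys n"
  unfolding norm_quotient_def by (rule monic_quotient_polys[OF quotient_facts])

lemma norm_quotient_add:
  "f \<in> polys n \<Longrightarrow> g \<in> polys n \<Longrightarrow> norm_quotient i (f + g) = norm_quotient i f + norm_quotient i g"
  unfolding norm_quotient_def by (rule monic_quotient_add[OF quotient_facts])

lemma norm_quotient_0: "norm_quotient i 0 = 0"
proof -
  have "norm_quotient i 0 + norm_quotient i 0 = norm_quotient i 0"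
    using norm_quotient_add[OF polys_0 polys_0] by simp
  then show ?thesis by (rule add_cancel_left_right[THEN iffD1])
qed

lemma norm_quotient_sum:
  "(\<And>a. a \<in> S \<Longrightarrow> f a \<in> polys n) \<Longrightarrow>
    norm_quotient i (sum f S) = (\<Sum>a\<in>S. norm_quotient i (f a))"
  by (induction S rule: infinite_finite_induct) (simp_all add: norm_quotient_0 norm_quotient_add polys_sum)

lemma norm_quotient_orbit_norm: "norm_quotient i (N i * f) = f"
  unfolding norm_quotient_def by (rule monic_quotient_mult_self[OF orbit_norm_monic[OF i]])

lemma norm_quotient_orbit_norm_other:
  "j \<in> {1..n} \<Longrightarrow> j \<noteq> i \<Longrightarrow> f \<in> polys n \<Longrightarrow> norm_quotient i (N j * f) = N j * norm_quotient i f"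
  unfolding norm_quotient_def using orbit_norm_degree[OF i, of j]
  by (intro monic_quotient_mult[OF quotient_facts]) auto

text \<open>Apply \<sigma> to the division identity of \<open>f\<close>: the norm is invariant and
  the remainder keeps its degree bound, so uniqueness of division identifies the quotient.\<close>

lemma norm_quotient_action:
  assumes "\<sigma> \<in> G" "f \<in> polys n"
  shows "norm_quotient i (action \<sigma> f) = action \<sigma> (norm_quotient i f)"
proof -
  have "degree_less i (card G) (action \<sigma> (f - norm_quotient i f * N i))"
    using assms i degree_less_monic_quotient[OF quotient_facts, of f]
    by (intro action_degree_less polys_diff polys_mult norm_quotient_polys orbit_norm_polys)
      (auto simp: norm_quotient_def)
  moreover have "action \<sigma> (N i) = N i"
    using orbit_norm_invariant[OF i_le_n] assms(1) by (simp add: invariants_def)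
  ultimately show ?thesis
    unfolding norm_quotient_def
    by (intro monic_quotient_eqI[OF orbit_norm_monic[OF i]]) (simp add: act_diff act_mult norm_quotient_def)
qed

lemma norm_quotient_invariants:
  "X \<subseteq> G \<Longrightarrow> f \<in> invariants n v x X \<Longrightarrow> norm_quotient i f \<in> invariants n v x X"
  by (auto simp: invariants_def norm_quotient_polys simp flip: norm_quotient_action)

end

subsection \<open>Transfer\<close>

lemma lcosets_eq: "lcosets\<^bsub>(GL scale)\<lparr>carrier := G\<rparr>\<^esub> X = (\<lambda>a. (\<circ>) a ` X) ` G"
  by (auto simp: LCOSETS_def l_coset_def GL_def image_def)

context
  fixes X assumes X: "subgroup X ((GL scale)\<lparr>carrier := G\<rparr>)"
begin

lemma X_subset: "X \<subseteq> G" and id_X: "id \<in> X"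
  using subgroup.subset[OF X] subgroup.one_closed[OF X] by (auto simp: GL_def)

abbreviation (input) "cosets \<equiv> (\<lambda>a. (\<circ>) a ` X) ` G"

lemma coset_representative:
  assumes "C \<in> cosets"
  shows "(SOME \<sigma>. \<sigma> \<in> C) \<in> C" "C \<subseteq> G"
proof -
  have "C \<noteq> {}" using assms id_X by auto
  then show "(SOME \<sigma>. \<sigma> \<in> C) \<in> C" by (simp add: some_in_eq)
  show "C \<subseteq> G" using assms X_subset by (auto intro: G_comp)
qed

text \<open>Two elements of a left coset differ by a right factor from \<open>X\<close>, which fixes
  \<open>f\<close>. The transfer is thus independent of the representatives chosen by
  \<open>SOME\<close>.\<close>

lemma action_coset_eq:
  assumes "C \<in> cosets" "\<sigma> \<in> C" "\<tau> \<in> C" "f \<in> invariants n v x X"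
  shows "action \<sigma> f = action \<tau> f"
proof -
  obtain a where a: "a \<in> G" "C = (\<circ>) a ` X" using assms(1) by auto
  have "action (a \<circ> h) f = action a f" if "h \<in> X" for h
    using that a(1) assms(4) X_subset action_comp[of a h f] by (auto simp: invariants_def)
  then show ?thesis using assms(2,3) a(2) by auto
qed

lemma comp_cosets:
  assumes "\<tau> \<in> G"
  shows "(`) ((\<circ>) \<tau>) ` cosets = cosets" "inj_on ((`) ((\<circ>) \<tau>)) cosets"
proof -
  have inj: "inj ((`) ((\<circ>) \<tau>))"
    using inj_image_eq_iff[OF inj_on_comp_G[OF assms]] by (intro injI) blast
  then show "inj_on ((`) ((\<circ>) \<tau>)) cosets" by (rule inj_on_subset) simp
  moreover have "(\<circ>) \<tau> ` (\<circ>) a ` X = (\<circ>) (\<tau> \<circ> a) ` X" for a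
    by (auto simp: image_image comp_assoc)
  then have "(`) ((\<circ>) \<tau>) ` cosets \<subseteq> cosets"
    using G_comp[OF assms] by (simp only: image_image) blast
  ultimately show "(`) ((\<circ>) \<tau>) ` cosets = cosets"
    using finite_G by (intro endo_inj_surj) auto
qed

text \<open>Left multiplication by \<tau> permutes the cosets, and with them the summands of the
  transfer.\<close>

lemma transfer_invariant:
  assumes f: "f \<in> invariants n v x X"
  shows "transfer scale n v x G X f \<in> invariants n v x G"
proof -
  let ?r = "\<lambda>C. SOME \<sigma>. \<sigma> \<in> C"
  have "action \<tau> (\<Sum>C\<in>cosets. action (?r C) f) = (\<Sum>C\<in>cosets. action (?r C) f)" if \<tau>: "\<tau> \<in> G" for \<tau>
  proof -
    have "action \<tau> (action (?r C) f) = action (?r ((\<circ>) \<tau> ` C)) f" if C: "C \<in> cosets" for C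
    proof -
      have C': "(\<circ>) \<tau> ` C \<in> cosets" using comp_cosets(1)[OF \<tau>] C by blast
      have "action \<tau> (action (?r C) f) = action (\<tau> \<circ> ?r C) f"
        using \<tau> coset_representative[OF C] f by (intro action_comp) (auto simp: invariants_def)
      \<comment> \<open>The translated representative need not be the chosen one of the translated
        coset, but both act on \<open>f\<close> alike.\<close>
      also have "\<dots> = action (?r ((\<circ>) \<tau> ` C)) f"
        using coset_representative(1)[OF C] coset_representative(1)[OF C'] f
        by (intro action_coset_eq[OF C']) auto
      finally show ?thesis .
    qed
    then have "action \<tau> (\<Sum>C\<in>cosets. action (?r C) f) = (\<Sum>C\<in>cosets. action (?r ((\<circ>) \<tau> ` C)) f)"
      by (simp add: act_sum)
    also have "\<dots> = (\<Sum>C\<in>(`) ((\<circ>) \<tau>) ` cosets. action (?r C) f)"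
      by (simp only: sum.reindex[OF comp_cosets(2)[OF \<tau>]] o_def)
    finally show ?thesis by (simp only: comp_cosets(1)[OF \<tau>])
  qed
  then show ?thesis
    by (auto simp: transfer_def lcosets_eq invariants_def intro: polys_sum act_polys)
qed

lemma transfer_add:
  "transfer scale n v x G X (f + g) = transfer scale n v x G X f + transfer scale n v x G X g"
  by (simp add: transfer_def act_add sum.distrib)

lemma transfer_0: "transfer scale n v x G X 0 = 0"
  by (simp add: transfer_def act_0)

lemma transfer_uminus: "transfer scale n v x G X (- f) = - transfer scale n v x G X f"
  by (simp add: transfer_def act_uminus sum_negf)

lemma transfer_mult:
  assumes "g \<in> invariants n v x G"
  shows "transfer scale n v x G X f * g = transfer scale n v x G X (f * g)"
  unfolding transfer_def sum_distrib_right lcosets_eq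
proof (rule sum.cong[OF refl])
  fix C assume "C \<in> cosets"
  then have "(SOME \<sigma>. \<sigma> \<in> C) \<in> G" using coset_representative by blast
  then show "action (SOME \<sigma>. \<sigma> \<in> C) f * g = action (SOME \<sigma>. \<sigma> \<in> C) (f * g)"
    using assms by (simp add: act_mult invariants_def)
qed

text \<open>The quotient map is additive and commutes with every coset representative.\<close>

lemma norm_quotient_transfer:
  assumes "i \<in> {1..l}" "f \<in> polys n"
  shows "norm_quotient i (transfer scale n v x G X f) = transfer scale n v x G X (norm_quotient i f)"
proof -
  have "norm_quotient i (action (SOME \<sigma>. \<sigma> \<in> C) f) = action (SOME \<sigma>. \<sigma> \<in> C) (norm_quotient i f)"
    if "C \<in> cosets" for C
    using coset_representative[OF that] assms by (intro norm_quotient_action) auto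
  then show ?thesis
    by (simp add: transfer_def lcosets_eq norm_quotient_sum[OF assms(1) act_polys])
qed

end

section \<open>The ideal of transfers and regularity modulo it\<close>

context
  fixes \<X> assumes \<X>: "\<And>X. X \<in> \<X> \<Longrightarrow> subgroup X ((GL scale)\<lparr>carrier := G\<rparr>)"
begin

text \<open>Chooses preimages for all summands at once, so that elements of the ideal can be handled
  through families \<open>f\<close>.\<close>

lemma transfer_ideal_eq:
  "transfer_ideal scale n v x G \<X> =
    {\<Sum>X\<in>\<X>. transfer scale n v x G X (f X) | f. \<forall>X\<in>\<X>. f X \<in> invariants n v x X}" (is "_ = ?I")
proof (intro equalityI subsetI)
  fix h assume "h \<in> transfer_ideal scale n v x G \<X>"
  then obtain t where t: "h = sum t \<X>"
    "\<forall>X\<in>\<X>. \<exists>f\<in>invariants n v x X. t X = transfer scale n v x G X f"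
    by (auto simp: transfer_ideal_def image_iff)
  from bchoice[OF t(2)[unfolded Bex_def]] obtain f where
    "\<forall>X\<in>\<X>. f X \<in> invariants n v x X \<and> t X = transfer scale n v x G X (f X)" by blast
  then show "h \<in> ?I" using t(1) by (auto intro!: exI[of _ f])
qed (auto simp: transfer_ideal_def)

lemma ideal_transfer_ideal: "ideal (transfer_ideal scale n v x G \<X>) (invariant_ring n v x G)"
proof (rule ideal_invariant_ringI)
  show "transfer_ideal scale n v x G \<X> \<subseteq> invariants n v x G"
    using \<X> by (auto simp: transfer_ideal_eq intro!: invariants_sum transfer_invariant)
  show "0 \<in> transfer_ideal scale n v x G \<X>"
    using \<X> by (auto simp: transfer_ideal_eq transfer_0 invariants_0 intro!: exI[of _ "\<lambda>_. 0"])
next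
  fix h k assume "h \<in> transfer_ideal scale n v x G \<X>" "k \<in> transfer_ideal scale n v x G \<X>"
  then obtain f g where "h = (\<Sum>X\<in>\<X>. transfer scale n v x G X (f X))" "\<forall>X\<in>\<X>. f X \<in> invariants n v x X"
    "k = (\<Sum>X\<in>\<X>. transfer scale n v x G X (g X))" "\<forall>X\<in>\<X>. g X \<in> invariants n v x X"
    by (auto simp: transfer_ideal_eq)
  then show "h + k \<in> transfer_ideal scale n v x G \<X>"
    using \<X> by (auto simp: transfer_ideal_eq transfer_add invariants_add sum.distrib
        intro!: exI[of _ "\<lambda>X. f X + g X"])
next
  fix h assume "h \<in> transfer_ideal scale n v x G \<X>"
  then obtain f where f: "h = (\<Sum>X\<in>\<X>. transfer scale n v x G X (f X))" "\<forall>X\<in>\<X>. f X \<in> invariants n v x X"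
    by (auto simp: transfer_ideal_eq)
  then show "- h \<in> transfer_ideal scale n v x G \<X>"
    using \<X> by (auto simp: transfer_ideal_eq transfer_uminus invariants_uminus sum_negf
        intro!: exI[of _ "\<lambda>X. - f X"])
  fix g assume g: "g \<in> invariants n v x G"
  \<comment> \<open>Elements invariant under \<open>G\<close> are invariant under \<open>X\<close>,
    so \<open>g\<close> can be absorbed into the argument of each transfer.\<close>
  have "f X * g \<in> invariants n v x X" if "X \<in> \<X>" for X
    using that g f(2) invariants_antimono[OF X_subset[OF \<X>[OF that]], of n v x]
    by (intro invariants_mult) auto
  then show "h * g \<in> transfer_ideal scale n v x G \<X>"
    using f \<X> g by (auto simp: transfer_ideal_eq transfer_mult sum_distrib_right
        intro!: exI[of _ "\<lambda>X. f X * g"])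
qed

lemma norm_quotient_transfer_ideal:
  assumes i: "i \<in> {1..l}" and "h \<in> transfer_ideal scale n v x G \<X>"
  shows "norm_quotient i h \<in> transfer_ideal scale n v x G \<X>"
proof -
  obtain f where h: "h = (\<Sum>X\<in>\<X>. transfer scale n v x G X (f X))"
    and f: "\<And>X. X \<in> \<X> \<Longrightarrow> f X \<in> invariants n v x X"
    using assms(2) by (auto simp: transfer_ideal_eq)
  have "norm_quotient i h = (\<Sum>X\<in>\<X>. norm_quotient i (transfer scale n v x G X (f X)))"
    unfolding h using transfer_invariant[OF \<X> f]
    by (intro norm_quotient_sum[OF i]) (auto simp: invariants_def)
  also have "\<dots> = (\<Sum>X\<in>\<X>. transfer scale n v x G X (norm_quotient i (f X)))"
    using f by (intro sum.cong refl norm_quotient_transfer[OF \<X> i]) (auto simp: invariants_def)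
  finally show ?thesis
    using norm_quotient_invariants[OF i X_subset[OF \<X>] f] by (auto simp: transfer_ideal_eq)
qed

text \<open>For each \<open>i\<close> the required left inverse of multiplication by
  \<open>N i\<close> is \<open>norm_quotient i\<close>.\<close>

theorem regular_sequence_orbit_norms:
  "regular_sequence (invariant_ring n v x G Quot transfer_ideal scale n v x G \<X>)
    (map (\<lambda>i. transfer_ideal scale n v x G \<X> +>\<^bsub>invariant_ring n v x G\<^esub> N i) [1..<Suc l])"
proof (rule cring.regular_sequence_QuotI[OF cring_invariant_ring ideal_transfer_ideal])
  fix i assume i: "i \<in> {1..l}"
  then show "N i \<in> carrier (invariant_ring n v x G)"
    using orbit_norm_invariant[OF i_le_n[OF i]] by (simp add: invariant_ring_def)
  have polys: "f \<in> polys n" if "f \<in> invariants n v x G" for f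
    using that by (simp add: invariants_def)
  show "\<exists>q\<in>carrier (invariant_ring n v x G) \<rightarrow> carrier (invariant_ring n v x G).
      q ` transfer_ideal scale n v x G \<X> \<subseteq> transfer_ideal scale n v x G \<X> \<and>
      (\<forall>y\<in>carrier (invariant_ring n v x G). \<forall>z\<in>carrier (invariant_ring n v x G).
        q (y \<oplus>\<^bsub>invariant_ring n v x G\<^esub> z) = q y \<oplus>\<^bsub>invariant_ring n v x G\<^esub> q z) \<and>
      (\<forall>y\<in>carrier (invariant_ring n v x G). q (N i \<otimes>\<^bsub>invariant_ring n v x G\<^esub> y) = y) \<and>
      (\<forall>j\<in>{1..l} - {i}. \<forall>y\<in>carrier (invariant_ring n v x G).
        q (N j \<otimes>\<^bsub>invariant_ring n v x G\<^esub> y) = N j \<otimes>\<^bsub>invariant_ring n v x G\<^esub> q y)"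
  proof (intro bexI[of _ "norm_quotient i"] conjI ballI)
    fix j y assume "j \<in> {1..l} - {i}" "y \<in> carrier (invariant_ring n v x G)"
    then show "norm_quotient i (N j \<otimes>\<^bsub>invariant_ring n v x G\<^esub> y) =
        N j \<otimes>\<^bsub>invariant_ring n v x G\<^esub> norm_quotient i y"
      using l_le_n by (simp add: invariant_ring_def norm_quotient_orbit_norm_other[OF i] polys)
  qed (use norm_quotient_transfer_ideal[OF i] in \<open>auto simp: invariant_ring_def polys
      norm_quotient_add[OF i]
      norm_quotient_orbit_norm[OF i] norm_quotient_invariants[OF i order_refl]\<close>)
qed

end

end

theorem proposition1:
  fixes scale :: "'k::field \<Rightarrow> 'v::ab_group_add \<Rightarrow> 'v"
    and p l n :: nat
    and G :: "('v \<Rightarrow> 'v) set"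
    and \<X> :: "('v \<Rightarrow> 'v) set set"
    and v :: "nat \<Rightarrow> 'v"
    and x :: "nat \<Rightarrow> 'v \<Rightarrow> 'k"
  assumes "prime p" and "CHAR('k) = p" and "infinite (UNIV :: 'k set)"
    and "vector_space scale"
    and "subgroup G (GL scale)" and "finite G" and "\<exists>a. card G = p ^ a" and "G \<noteq> {id}"
    and "\<forall>X\<in>\<X>. subgroup X ((GL scale)\<lparr>carrier := G\<rparr>) \<and> X \<noteq> G"
    and "l \<le> n"
    and "is_basis scale v l (fixed_space G)"
    and "is_basis scale v n UNIV"
    and "is_dual_basis scale v n x"
  shows "regular_sequence
    (invariant_ring n v x G Quot transfer_ideal scale n v x G \<X>)
    (map (\<lambda>i. transfer_ideal scale n v x G \<X> +>\<^bsub>invariant_ring n v x G\<^esub> orbit_norm n v x G i)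
       [1..<Suc l])"
proof -
  interpret vector_space scale by fact
  interpret linear_action scale l n G v x
  proof (intro linear_action.intro linear_action_axioms.intro)
    \<comment> \<open>Each of the first \<open>l\<close> basis vectors lies in the span of all of
      them, which is the fixed space.\<close>
    show "v i \<in> fixed_space G" if "i \<in> {1..l}" for i
      using assms(11) that span_base[of "v i" "v ` {1..l}"] by (auto simp: is_basis_def)
  qed (fact assms)+
  show ?thesis
    using assms(9) by (intro regular_sequence_orbit_norms) blast
qed

end
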